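(* Let $\gamma,\gamma'\in(-\infty,1/2]$ with $\gamma\ne\gamma'$. Then there exists no orbit equivalence between the shearlet groups $G_\gamma$ and $G_{\gamma'}$, i.e. there is no orbit equivalence between any data set $(G_\gamma,dh,X,Y)$ of $G_\gamma$ and any data set $(G_{\gamma'},dh',X',Y')$ of $G_{\gamma'}$.
   Context: Shearlet groups. For $\gamma\le1/2$ let $G_\gamma=\Sigma_3^\perp\rtimes H_\gamma$, where $$\Sigma_3^\perp=\left\{\begin{bmatrix}0&v/2\\ v/2&u\end{bmatrix}:u,v\in\mathbb{R}\right\},\qquad H_\gamma=\left\{h_{a,s}=\begin{bmatrix}a^{\frac12-\gamma}&-sa^{-1/2}\\ 0&a^{-1/2}\end{bmatrix}:a>0,\ s\in\mathbb{R}\right\}.$$ Here, for a linear subspace $\Sigma$ of the symmetric $d\times d$ real matrices and a connected Lie subgroup $H$ of $GL(d,\mathbb{R})$ with ${}^th^{-1}\Sigma h^{-1}=\Sigma$ for all $h\in H$, $\Sigma\rtimes H$ denotes the subgroup of the symplectic group $Sp(d,\mathbb{R})$ $$\left\{\begin{bmatrix}h&0\\ \sigma h&{}^th^{-1}\end{bmatrix}:h\in H,\ \sigma\in\Sigma\right\}.$$ General notation. Fix a basis $\sigma_1,\dots,\sigma_n$ of $\Sigma$, identifying $\Sigma$ and, via the dual basis, its dual $\Sigma^*$ with $\mathbb{R}^n$. Let $M_h\in GL(n,\mathbb{R})$ be the matrix of $\sigma\mapsto {}^th^{-1}\sigma h^{-1}$ and let $H$ act on $\mathbb{R}^n\simeq\Sigma^*$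 by $h[y]={}^tM_h^{-1}y$, and on $\mathbb{R}^d$ by $x\mapsto hx$. Let $\Phi=(\varphi_1,\dots,\varphi_n):\mathbb{R}^d\to\mathbb{R}^n$, $\varphi_i(x)=-\frac12\langle\sigma_ix,x\rangle$, so that $\Phi(hx)=h[\Phi(x)]$, and $J\Phi(x)=\sqrt{\det(D\Phi(x)\,{}^tD\Phi(x))}$. Data sets. A data set $(\Sigma\rtimes H,dh,X,Y)$ consists of such a group for which every orbit $H[y]$, $y\in\mathbb{R}^n$, is locally closed in $\mathbb{R}^n$, a chosen left Haar measure $dh$ of $H$, an open $H$-invariant set $X\subset\mathbb{R}^d$ with Lebesgue negligible complement on which $J\Phi>0$, and $Y=\Phi(X)$ (an open $H$-invariant subset of $\mathbb{R}^n$). For a second data set all objects are denoted with primes. Orbit equivalence. An orbit map between $(\Sigma\rtimes H,dh,X,Y)$ and $(\Sigma'\rtimes H',dh',X',Y')$ is a triple $(\theta,\psi,\xi)$ such that: (OM1) $\theta:H\to H'$ is an isomorphism of Lie groups such that $dh'=\theta_*dh$ (image measure); (OM2) $\psi:X\to X'$ is a diffeomorphism with $\psi(hx)=\theta(h)\psi(x)$ for all $h\in H$, $x\in X$; (OM3) $\xi:Y\to Y'$ is a diffeomorphism with $\xi(\Phi(x))=\Phi'(\psi(x))$ for all $x\in X$. An orbit map is an orbit equivalence if the Jacobian $J\xi$ (absolute value of the Jacobian determinant of $\xi$) is a positive constant on $Y$. *)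

theory Defs
  imports "HOL-Analysis.Analysis"
begin

section \<open>Smooth maps and embedded submanifolds\<close>

text \<open>\<^term>\<open>Ck_on k f S\<close> is meant for open \<^term>\<open>S\<close>: all iterated directional derivatives of
  order at most \<^term>\<open>k\<close> exist and are continuous.\<close>

primrec Ck_on ::
  "nat \<Rightarrow> ('a::euclidean_space \<Rightarrow> 'b::euclidean_space) \<Rightarrow> 'a set \<Rightarrow> bool" where
  "Ck_on 0 f S \<longleftrightarrow> continuous_on S f"
| "Ck_on (Suc k) f S \<longleftrightarrow>
     (\<forall>x\<in>S. f differentiable (at x)) \<and>
     (\<forall>v. Ck_on k (\<lambda>x. frechet_derivative f (at x) v) S)"

text \<open>On an arbitrary subset, smoothness means local extendability to a smooth map on an open set.
  For open sets this is ordinary smoothness, and for embedded submanifolds it is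
  smoothness with respect to the manifold structure.\<close>

definition smooth_on ::
  "'a::euclidean_space set \<Rightarrow> ('a \<Rightarrow> 'b::euclidean_space) \<Rightarrow> bool" where
  "smooth_on S f \<longleftrightarrow>
     (\<forall>x\<in>S. \<exists>U g. open U \<and> x \<in> U \<and> (\<forall>k. Ck_on k g U) \<and> (\<forall>y\<in>U \<inter> S. g y = f y))"

definition diffeomorphism ::
  "'a::euclidean_space set \<Rightarrow> 'b::euclidean_space set \<Rightarrow> ('a \<Rightarrow> 'b) \<Rightarrow> bool" where
  "diffeomorphism S T f \<longleftrightarrow>
     bij_betw f S T \<and> smooth_on S f \<and> smooth_on T (inv_into S f)"

definition embedded_submanifold :: "'a::euclidean_space set \<Rightarrow> bool" where
  "embedded_submanifold S \<longleftrightarrow>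
     (\<forall>x\<in>S. \<exists>U V (F :: 'a \<Rightarrow> 'a) L. open U \<and> x \<in> U \<and> open V \<and>
        diffeomorphism U V F \<and> subspace L \<and> F ` (S \<inter> U) = V \<inter> L)"

definition locally_closed_set :: "'a::topological_space set \<Rightarrow> bool" where
  "locally_closed_set S \<longleftrightarrow> (\<exists>U C. open U \<and> closed C \<and> S = U \<inter> C)"


section \<open>Matrix Lie groups and Haar measures\<close>

text \<open>The Lie group structure of \<^term>\<open>H\<close> is that of a submanifold of the space of matrices.\<close>

definition connected_Lie_subgroup_GL :: "(real^'d^'d) set \<Rightarrow> bool" where
  "connected_Lie_subgroup_GL H \<longleftrightarrow>
     (\<forall>h\<in>H. invertible h) \<and> mat 1 \<in> H \<and>
     (\<forall>g\<in>H. \<forall>h\<in>H. g ** h \<in> H) \<and> (\<forall>h\<in>H. matrix_inv h \<in> H) \<and>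
     embedded_submanifold H \<and> connected H"

text \<open>Since \<^term>\<open>H\<close> is second countable and locally compact, a Borel measure which is finite on
  compact sets is automatically regular.\<close>

definition left_Haar_measure :: "(real^'d^'d) set \<Rightarrow> (real^'d^'d) measure \<Rightarrow> bool" where
  "left_Haar_measure H \<mu> \<longleftrightarrow>
     sets \<mu> = sets (restrict_space borel H) \<and>
     (\<forall>K. compact K \<and> K \<subseteq> H \<longrightarrow> emeasure \<mu> K < \<infinity>) \<and>
     emeasure \<mu> H \<noteq> 0 \<and>
     (\<forall>h\<in>H. distr \<mu> \<mu> (\<lambda>g. h ** g) = \<mu>)"

definition Lie_group_isomorphism ::
  "(real^'d^'d) set \<Rightarrow> (real^'d^'d) set \<Rightarrow> (real^'d^'d \<Rightarrow> real^'d^'d) \<Rightarrow> bool" where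
  "Lie_group_isomorphism H H' \<theta> \<longleftrightarrow>
     diffeomorphism H H' \<theta> \<and> (\<forall>g\<in>H. \<forall>h\<in>H. \<theta> (g ** h) = \<theta> g ** \<theta> h)"


section \<open>The groups and their actions\<close>

definition block_matrix ::
  "real^'d^'d \<Rightarrow> real^'d^'d \<Rightarrow> real^'d^'d \<Rightarrow> real^'d^'d \<Rightarrow> real^('d + 'd)^('d + 'd)" where
  "block_matrix A B C D = (\<chi> i j. case i of
      Inl k \<Rightarrow> (case j of Inl l \<Rightarrow> A $ k $ l | Inr l \<Rightarrow> B $ k $ l)
    | Inr k \<Rightarrow> (case j of Inl l \<Rightarrow> C $ k $ l | Inr l \<Rightarrow> D $ k $ l))"

definition conj_action :: "real^'d^'d \<Rightarrow> real^'d^'d \<Rightarrow> real^'d^'d" where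
  "conj_action h s = transpose (matrix_inv h) ** s ** matrix_inv h"

definition symp_semidirect ::
  "(real^'d^'d) set \<Rightarrow> (real^'d^'d) set \<Rightarrow> (real^('d + 'd)^('d + 'd)) set" where
  "symp_semidirect \<Sigma> H =
     {block_matrix h 0 (s ** h) (transpose (matrix_inv h)) | h s. h \<in> H \<and> s \<in> \<Sigma>}"

definition is_basis_family :: "('n::finite \<Rightarrow> 'v::real_vector) \<Rightarrow> 'v set \<Rightarrow> bool" where
  "is_basis_family b V \<longleftrightarrow> inj b \<and> independent (range b) \<and> span (range b) = V"

text \<open>The matrix of \<^term>\<open>conj_action h\<close> in the basis \<^term>\<open>b\<close>: its \<open>j\<close>-th column consists of
  the coordinates of the image of \<open>b j\<close>.\<close>

definition action_matrix :: "('n::finite \<Rightarrow> real^'d^'d) \<Rightarrow> real^'d^'d \<Rightarrow> real^'n^'n" where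
  "action_matrix b h = (\<chi> i j. representation (range b) (conj_action h (b j)) (b i))"

definition dual_action :: "('n::finite \<Rightarrow> real^'d^'d) \<Rightarrow> real^'d^'d \<Rightarrow> real^'n \<Rightarrow> real^'n" where
  "dual_action b h y = transpose (matrix_inv (action_matrix b h)) *v y"

definition Phi :: "('n::finite \<Rightarrow> real^'d^'d) \<Rightarrow> real^'d \<Rightarrow> real^'n" where
  "Phi b x = (\<chi> i. - (1/2) * ((b i *v x) \<bullet> x))"

definition J_Phi :: "('n::finite \<Rightarrow> real^'d^'d) \<Rightarrow> real^'d \<Rightarrow> real" where
  "J_Phi b x = sqrt (det (jacobian (Phi b) (at x) ** transpose (jacobian (Phi b) (at x))))"


section \<open>Data sets\<close>

record ('d::finite, 'n::finite) data_tuple =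
  ds_Sigma :: "(real^'d^'d) set"
  ds_H :: "(real^'d^'d) set"
  ds_basis :: "'n \<Rightarrow> real^'d^'d"
  ds_Haar :: "(real^'d^'d) measure"
  ds_X :: "(real^'d) set"
  ds_Y :: "(real^'n) set"

definition ds_group :: "('d::finite, 'n::finite) data_tuple \<Rightarrow> (real^('d + 'd)^('d + 'd)) set" where
  "ds_group D = symp_semidirect (ds_Sigma D) (ds_H D)"

definition is_data_set :: "('d::finite, 'n::finite) data_tuple \<Rightarrow> bool" where
  "is_data_set D \<longleftrightarrow>
     subspace (ds_Sigma D) \<and> (\<forall>s\<in>ds_Sigma D. transpose s = s) \<and>
     connected_Lie_subgroup_GL (ds_H D) \<and>
     (\<forall>h\<in>ds_H D. conj_action h ` ds_Sigma D = ds_Sigma D) \<and>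
     is_basis_family (ds_basis D) (ds_Sigma D) \<and>
     (\<forall>y. locally_closed_set ((\<lambda>h. dual_action (ds_basis D) h y) ` ds_H D)) \<and>
     left_Haar_measure (ds_H D) (ds_Haar D) \<and>
     open (ds_X D) \<and> (\<forall>h\<in>ds_H D. \<forall>x\<in>ds_X D. h *v x \<in> ds_X D) \<and>
     negligible (- ds_X D) \<and> (\<forall>x\<in>ds_X D. J_Phi (ds_basis D) x > 0) \<and>
     ds_Y D = Phi (ds_basis D) ` ds_X D"


section \<open>Orbit equivalence\<close>

definition orbit_map ::
  "('d::finite, 'n::finite) data_tuple \<Rightarrow> ('d, 'n) data_tuple \<Rightarrow>
   (real^'d^'d \<Rightarrow> real^'d^'d) \<Rightarrow> (real^'d \<Rightarrow> real^'d) \<Rightarrow> (real^'n \<Rightarrow> real^'n) \<Rightarrow> bool" where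
  "orbit_map D D' \<theta> \<psi> \<xi> \<longleftrightarrow>
     Lie_group_isomorphism (ds_H D) (ds_H D') \<theta> \<and>
     ds_Haar D' = distr (ds_Haar D) (ds_Haar D') \<theta> \<and>
     diffeomorphism (ds_X D) (ds_X D') \<psi> \<and>
     (\<forall>h\<in>ds_H D. \<forall>x\<in>ds_X D. \<psi> (h *v x) = \<theta> h *v \<psi> x) \<and>
     diffeomorphism (ds_Y D) (ds_Y D') \<xi> \<and>
     (\<forall>x\<in>ds_X D. \<xi> (Phi (ds_basis D) x) = Phi (ds_basis D') (\<psi> x))"

definition orbit_equivalence ::
  "('d::finite, 'n::finite) data_tuple \<Rightarrow> ('d, 'n) data_tuple \<Rightarrow>
   (real^'d^'d \<Rightarrow> real^'d^'d) \<Rightarrow> (real^'d \<Rightarrow> real^'d) \<Rightarrow> (real^'n \<Rightarrow> real^'n) \<Rightarrow> bool" where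
  "orbit_equivalence D D' \<theta> \<psi> \<xi> \<longleftrightarrow>
     orbit_map D D' \<theta> \<psi> \<xi> \<and>
     (\<exists>c>0. \<forall>y\<in>ds_Y D. \<bar>det (jacobian \<xi> (at y))\<bar> = c)"


section \<open>Shearlet groups\<close>

definition Sigma3_perp :: "(real^2^2) set" where
  "Sigma3_perp = {vector [vector [0, v/2], vector [v/2, u]] | u v. True}"

definition shearlet_h :: "real \<Rightarrow> real \<Rightarrow> real \<Rightarrow> real^2^2" where
  "shearlet_h \<gamma> a s =
     vector [vector [a powr (1/2 - \<gamma>), - s * a powr (-1/2)],
             vector [0, a powr (-1/2)]]"

definition shearlet_H :: "real \<Rightarrow> (real^2^2) set" where
  "shearlet_H \<gamma> = {shearlet_h \<gamma> a s | a s. a > 0}"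

definition shearlet_group :: "real \<Rightarrow> (real^(2 + 2)^(2 + 2)) set" where
  "shearlet_group \<gamma> = symp_semidirect Sigma3_perp (shearlet_H \<gamma>)"

end

theory Submission
  imports Defs
begin

text \<open>
  An orbit equivalence preserves two numbers attached to an element \<open>h = shearlet_h \<gamma> a s\<close>, and for
  \<open>a \<noteq> 1\<close> these determine \<open>\<gamma>\<close>.

  The first comes from the group. Since \<open>shearlet_H \<gamma>\<close> is the group of affine maps
  \<open>t \<mapsto> a powr (1 - \<gamma>) * t + s\<close>, the factor \<open>a powr (1 - \<gamma>)\<close> is the one by which conjugation with
  \<open>h\<close> stretches the translations, and it can be read off from the multiplication alone. It suffices
  to know this for the value 2, where it is the relation \<open>g u = u\<^sup>2 g\<close> with a translation \<open>u\<close>, which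
  any homomorphism preserves (\<open>shearlet_hom_dilation\<close>).

  The second comes from the action on the range of \<open>\<Phi>\<close>. There \<open>h\<close> acts linearly with determinant
  \<open>a powr (- (1 + \<gamma>))\<close> (\<open>shearlet_Phi_equivariant\<close>). The map \<open>\<xi>\<close> intertwines the actions of
  \<open>h\<close> and \<open>\<theta> h\<close>, so by the chain rule a constant Jacobian of \<open>\<xi>\<close> forces their determinants to agree
  up to sign (\<open>det_eq_if_intertwines\<close>).

  If \<open>a powr (1 - \<gamma>) = 2\<close> and \<open>\<theta>\<close> sends \<open>shearlet_h \<gamma> a 0\<close> to \<open>shearlet_h \<gamma>' a' s'\<close>, then
  \<open>(1 - \<gamma>) * ln a = (1 - \<gamma>') * ln a' = ln 2\<close> and \<open>(1 + \<gamma>) * ln a = (1 + \<gamma>') * ln a'\<close>.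
  Adding the two gives \<open>ln a = ln a'\<close>, which is nonzero, and hence \<open>\<gamma> = \<gamma>'\<close>.
\<close>

section \<open>Recovering the factors of the semidirect product\<close>

lemma block_matrix_eq_iff:
  "block_matrix A B C D = block_matrix A' B' C' D' \<longleftrightarrow> A = A' \<and> B = B' \<and> C = C' \<and> D = D'"
proof
  assume eq: "block_matrix A B C D = block_matrix A' B' C' D'"
  have "block_matrix A B C D $ i $ j = block_matrix A' B' C' D' $ i $ j" for i j
    using eq by simp
  from this[of "Inl _" "Inl _"] this[of "Inl _" "Inr _"] this[of "Inr _" "Inl _"]
    this[of "Inr _" "Inr _"]
  show "A = A' \<and> B = B' \<and> C = C' \<and> D = D'"
    by (simp add: block_matrix_def vec_eq_iff)
qed simp

text \<open>A data set is only known through its group of block matrices; the diagonal blocks give back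
  \<open>H\<close>, and the elements over the identity of \<open>H\<close> give back \<open>\<Sigma>\<close>.\<close>

lemma symp_semidirect_subset_imp_subset:
  assumes sub: "symp_semidirect \<Sigma> H \<subseteq> symp_semidirect \<Sigma>' H'"
    and "0 \<in> \<Sigma>" "mat 1 \<in> H"
  shows "H \<subseteq> H'" and "\<Sigma> \<subseteq> \<Sigma>'"
proof -
  have *: "h \<in> H' \<and> (\<exists>s'\<in>\<Sigma>'. s ** h = s' ** h)" if "h \<in> H" "s \<in> \<Sigma>" for h s
  proof -
    have "block_matrix h 0 (s ** h) (transpose (matrix_inv h)) \<in> symp_semidirect \<Sigma>' H'"
      using sub that unfolding symp_semidirect_def by blast
    then show ?thesis
      unfolding symp_semidirect_def by (auto simp: block_matrix_eq_iff)
  qed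
  show "H \<subseteq> H'" using * \<open>0 \<in> \<Sigma>\<close> by blast
  show "\<Sigma> \<subseteq> \<Sigma>'" using *[OF \<open>mat 1 \<in> H\<close>] by auto
qed

lemma symp_semidirect_inject:
  assumes "symp_semidirect \<Sigma> H = symp_semidirect \<Sigma>' H'"
    and "0 \<in> \<Sigma>" "mat 1 \<in> H" "0 \<in> \<Sigma>'" "mat 1 \<in> H'"
  shows "\<Sigma> = \<Sigma>'" and "H = H'"
  using symp_semidirect_subset_imp_subset[of \<Sigma> H \<Sigma>' H']
    symp_semidirect_subset_imp_subset[of \<Sigma>' H' \<Sigma> H] assms by auto

lemma matrix_eq_2: "A = B \<longleftrightarrow> A$1$1 = B$1$1 \<and> A$1$2 = B$1$2 \<and> A$2$1 = B$2$1 \<and> A$2$2 = B$2$2"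
  for A B :: "real^2^2"
  by (auto simp: vec_eq_iff forall_2)

lemma mat_1_in_shearlet_H: "mat 1 \<in> shearlet_H \<gamma>"
proof -
  have "mat 1 = shearlet_h \<gamma> 1 0"
    by (simp add: matrix_eq_2 shearlet_h_def mat_def)
  then show ?thesis unfolding shearlet_H_def by (metis (mono_tags, lifting) mem_Collect_eq zero_less_one)
qed

lemma zero_in_Sigma3_perp: "0 \<in> Sigma3_perp"
  unfolding Sigma3_perp_def by (rule CollectI, rule exI[of _ 0], rule exI[of _ 0]) (simp add: matrix_eq_2)

lemma shearlet_data_set:
  fixes D :: "(2, 2) data_tuple"
  assumes "is_data_set D" "ds_group D = shearlet_group \<gamma>"
  shows "ds_Sigma D = Sigma3_perp" and "ds_H D = shearlet_H \<gamma>"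
proof -
  have "0 \<in> ds_Sigma D" "mat 1 \<in> ds_H D"
    using assms(1) by (auto simp: is_data_set_def connected_Lie_subgroup_GL_def subspace_0)
  moreover have "symp_semidirect (ds_Sigma D) (ds_H D) = symp_semidirect Sigma3_perp (shearlet_H \<gamma>)"
    using assms(2) by (simp add: ds_group_def shearlet_group_def)
  ultimately show "ds_Sigma D = Sigma3_perp" "ds_H D = shearlet_H \<gamma>"
    using symp_semidirect_inject[OF _ _ _ zero_in_Sigma3_perp mat_1_in_shearlet_H] by metis+
qed

section \<open>Homomorphisms between shearlet dilation groups\<close>

lemma shearlet_h_mult:
  assumes "a > 0" "b > 0"
  shows "shearlet_h \<gamma> a s ** shearlet_h \<gamma> b t = shearlet_h \<gamma> (a * b) (s + a powr (1 - \<gamma>) * t)"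
proof -
  have "a powr (1 - \<gamma>) * a powr (-1/2) = a powr (1/2 - \<gamma>)"
    by (simp flip: powr_add)
  then have "t * a powr (1/2 - \<gamma>) * b powr (-1/2) =
      t * (a powr (1 - \<gamma>) * a powr (-1/2)) * b powr (-1/2)" by simp
  with assms show ?thesis
    by (auto simp: matrix_eq_2 shearlet_h_def matrix_matrix_mult_def sum_2 powr_mult algebra_simps)
qed

lemma shearlet_h_inject:
  assumes "a > 0" "b > 0"
  shows "shearlet_h \<gamma> a s = shearlet_h \<gamma> b t \<longleftrightarrow> a = b \<and> s = t"
proof -
  have "a = b" if "a powr (-1/2) = b powr (-1/2)"
  proof -
    have "(a powr (-1/2)) powr (-2) = (b powr (-1/2)) powr (-2)" using that by simp
    then show ?thesis using assms by (simp add: powr_powr)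
  qed
  then show ?thesis
    using assms by (auto simp: matrix_eq_2 shearlet_h_def)
qed

lemma shearlet_h_in_H [simp]: "a > 0 \<Longrightarrow> shearlet_h \<gamma> a s \<in> shearlet_H \<gamma>"
  unfolding shearlet_H_def by blast

lemma shearlet_H_E:
  assumes "h \<in> shearlet_H \<gamma>"
  obtains a s where "a > 0" "h = shearlet_h \<gamma> a s"
  using assms unfolding shearlet_H_def by blast

text \<open>With \<open>g = shearlet_h \<gamma> a 0\<close> and \<open>u = shearlet_h \<gamma> 1 1\<close> one has \<open>g u = u\<^sup>2 g\<close>. Comparing dilation
  parameters in the image of this relation shows that \<open>\<theta> u\<close> is again a translation, nontrivial by
  injectivity; comparing translation parameters, \<open>\<theta> g\<close> then also stretches by 2.\<close>

lemma shearlet_hom_dilation: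
  assumes maps: "\<theta> \<in> shearlet_H \<gamma> \<rightarrow> shearlet_H \<gamma>'"
    and inj: "inj_on \<theta> (shearlet_H \<gamma>)"
    and hom: "\<And>g h. g \<in> shearlet_H \<gamma> \<Longrightarrow> h \<in> shearlet_H \<gamma> \<Longrightarrow> \<theta> (g ** h) = \<theta> g ** \<theta> h"
    and a: "a > 0" "a powr (1 - \<gamma>) = 2"
  obtains a' s' where "a' > 0" "\<theta> (shearlet_h \<gamma> a 0) = shearlet_h \<gamma>' a' s'" "a' powr (1 - \<gamma>') = 2"
proof -
  let ?g = "shearlet_h \<gamma> a 0" and ?u = "shearlet_h \<gamma> 1 1" and ?e = "shearlet_h \<gamma> 1 0"
  obtain a' s' where g': "a' > 0" "\<theta> ?g = shearlet_h \<gamma>' a' s'"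
    using maps a by (meson PiE shearlet_H_E shearlet_h_in_H)
  obtain b t where u': "b > 0" "\<theta> ?u = shearlet_h \<gamma>' b t"
    using maps by (meson PiE shearlet_H_E shearlet_h_in_H zero_less_one)
  obtain d r where e': "d > 0" "\<theta> ?e = shearlet_h \<gamma>' d r"
    using maps by (meson PiE shearlet_H_E shearlet_h_in_H zero_less_one)
  \<comment> \<open>An idempotent of a group is its unit, so \<open>\<theta> ?e\<close> is the identity matrix.\<close>
  have "?e ** ?e = ?e" by (simp add: shearlet_h_mult)
  then have "\<theta> ?e ** \<theta> ?e = \<theta> ?e" using hom[of ?e ?e] by simp
  then have "d = 1" "r = 0" using e' by (auto simp: shearlet_h_mult shearlet_h_inject)
  have "?g ** ?u = (?u ** ?u) ** ?g" using a by (simp add: shearlet_h_mult)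
  moreover have "?u ** ?u \<in> shearlet_H \<gamma>" by (simp add: shearlet_h_mult)
  ultimately have "\<theta> ?g ** \<theta> ?u = (\<theta> ?u ** \<theta> ?u) ** \<theta> ?g"
    using hom[of ?g ?u] hom[of "?u ** ?u" ?g] hom[of ?u ?u] a by simp
  then have rel: "a' * b = b * b * a'"
      "s' + a' powr (1 - \<gamma>') * t = t + b powr (1 - \<gamma>') * t + (b * b) powr (1 - \<gamma>') * s'"
    using g' u' by (simp_all add: shearlet_h_mult shearlet_h_inject)
  from rel(1) have "b = 1" using g' u' by simp
  have "?u \<noteq> ?e" by (simp add: shearlet_h_inject)
  then have "\<theta> ?u \<noteq> \<theta> ?e" using inj by (simp add: inj_on_eq_iff)
  then have "t \<noteq> 0" using u' e' \<open>b = 1\<close> \<open>d = 1\<close> \<open>r = 0\<close> by auto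
  then have "a' powr (1 - \<gamma>') = 2" using rel(2) \<open>b = 1\<close> by simp
  with g' that show ?thesis by blast
qed

section \<open>The action on the range of \<open>\<Phi>\<close>\<close>

text \<open>Up to an invertible matrix that depends on the basis of \<^term>\<open>Sigma3_perp\<close>, this is \<open>\<Phi>\<close>;
  \<open>quad_action\<close> below is the linear action on its range.\<close>

definition quad_map :: "real^2 \<Rightarrow> real^2" where
  "quad_map x = vector [(x$2)\<^sup>2, x$1 * x$2]"

definition quad_action :: "real \<Rightarrow> real \<Rightarrow> real \<Rightarrow> real^2^2" where
  "quad_action \<gamma> a s = vector [vector [1 / a, 0], vector [- s / a, a powr (- \<gamma>)]]"

lemma powr_minus_half_square: "a > 0 \<Longrightarrow> a powr (-1/2) * a powr (-1/2) = 1 / a" for a :: real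
  by (simp add: powr_minus_divide flip: powr_add)

lemma quad_map_shearlet_h:
  assumes "a > 0"
  shows "quad_map (shearlet_h \<gamma> a s *v x) = quad_action \<gamma> a s *v quad_map x"
proof -
  have 1: "a powr (1/2 - \<gamma>) * a powr (-1/2) = a powr (- \<gamma>)"
    by (simp flip: powr_add)
  have 2: "a powr (-1/2) * a powr (-1/2) = 1 / a"
    by (rule powr_minus_half_square[OF assms])
  have "(a powr (1/2 - \<gamma>) * x$1 - s * a powr (-1/2) * x$2) * (a powr (-1/2) * x$2) =
      (a powr (1/2 - \<gamma>) * a powr (-1/2)) * (x$1 * x$2) - s * (a powr (-1/2) * a powr (-1/2)) * (x$2)\<^sup>2"
    by (simp add: algebra_simps power2_eq_square)
  moreover have "(a powr (-1/2) * x$2)\<^sup>2 = (a powr (-1/2) * a powr (-1/2)) * (x$2)\<^sup>2"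
    by (simp add: power2_eq_square)
  ultimately show ?thesis unfolding 1 2
    by (simp add: vec_eq_iff forall_2 quad_map_def quad_action_def shearlet_h_def
        matrix_vector_mult_def sum_2)
qed

lemma det_quad_action:
  assumes "a > 0"
  shows "det (quad_action \<gamma> a s) = a powr (- (1 + \<gamma>))"
proof -
  have "a powr (- (1 + \<gamma>)) = a powr (- \<gamma>) / a"
    using powr_diff[of a "- \<gamma>" 1] assms by (simp add: minus_diff_commute)
  with assms show ?thesis
    by (simp add: det_2 quad_action_def)
qed

text \<open>The rows of \<open>P\<close> are, up to constants, the coordinates of the basis vectors, so \<open>P\<close> is invertible
  because the basis is independent.\<close>

lemma Phi_Sigma3_perp:
  fixes b :: "2 \<Rightarrow> real^2^2"
  assumes "is_basis_family b Sigma3_perp"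
  obtains P :: "real^2^2" where "invertible P" "\<And>x. Phi b x = P *v quad_map x"
proof -
  define P :: "real^2^2" where "P = (\<chi> i j. if j = 1 then - (b i $2$2) / 2 else - (b i $1$2))"
  from assms have inj: "inj b" and ind: "independent (range b)" and sp: "span (range b) = Sigma3_perp"
    by (auto simp: is_basis_family_def)
  have b: "b i $1$1 = 0" "b i $2$1 = b i $1$2" for i
  proof -
    have "b i \<in> Sigma3_perp" unfolding sp[symmetric] by (rule span_base) simp
    then show "b i $1$1 = 0" "b i $2$1 = b i $1$2" by (auto simp: Sigma3_perp_def)
  qed
  have "Phi b x = P *v quad_map x" for x
    by (simp add: vec_eq_iff forall_2 Phi_def P_def quad_map_def matrix_vector_mult_def
        sum_2 inner_vec_def b power2_eq_square field_simps)
  moreover have "det (transpose P) \<noteq> 0"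
  proof
    assume "det (transpose P) = 0"
    then obtain c where c: "c \<noteq> 0" "transpose P *v c = 0"
      by (metis invertible_det_nz invertible_left_inverse matrix_left_invertible_ker)
    have "c$1 * P$1$j + c$2 * P$2$j = 0" for j
      using c(2) by (auto simp: vec_eq_iff matrix_vector_mult_def transpose_def sum_2 mult.commute)
    from this[of 1] this[of 2] have "(\<Sum>i\<in>UNIV. c$i *\<^sub>R b i) = 0"
      by (simp add: matrix_eq_2 sum_2 P_def b)
    then have "(\<Sum>v\<in>range b. c $ (inv b v) *\<^sub>R v) = 0"
      using inj by (simp add: sum.reindex)
    then have "c $ inv b (b i) = 0" for i
      using independentD[OF ind, of "range b" "\<lambda>v. c $ inv b v" "b i"] by auto
    then have "c = 0" using inj by (simp add: vec_eq_iff)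
    with c(1) show False by simp
  qed
  ultimately show ?thesis using that by (simp add: invertible_det_nz)
qed

text \<open>A change of basis conjugates the action, which leaves its determinant unchanged.\<close>

lemma shearlet_Phi_equivariant:
  fixes P :: "real^2^2"
  assumes P: "invertible P" "\<And>x. Phi b x = P *v quad_map x" and a: "a > 0"
  obtains A where "det A = a powr (- (1 + \<gamma>))" "\<And>x. Phi b (shearlet_h \<gamma> a s *v x) = A *v Phi b x"
proof -
  obtain Q where PQ: "P ** Q = mat 1" "Q ** P = mat 1" using P(1) unfolding invertible_def by blast
  define A where "A = P ** quad_action \<gamma> a s ** Q"
  have "det P * det Q = 1" using PQ(1) by (metis det_I det_mul)
  then have "det A = det (quad_action \<gamma> a s)" by (simp add: A_def det_mul)
  moreover have "A ** P = P ** quad_action \<gamma> a s"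
    using PQ(2) by (simp add: A_def flip: matrix_mul_assoc)
  then have "Phi b (shearlet_h \<gamma> a s *v x) = A *v Phi b x" for x
    using a by (simp add: P(2) quad_map_shearlet_h matrix_vector_mul_assoc)
  ultimately show ?thesis using that a by (simp add: det_quad_action)
qed

text \<open>The open upper half-plane is a single orbit, and a conull set has to meet it.\<close>

lemma shearlet_upper_half_plane_subset:
  assumes inv: "\<And>h x. h \<in> shearlet_H \<gamma> \<Longrightarrow> x \<in> X \<Longrightarrow> h *v x \<in> X"
    and neg: "negligible (- X)"
  shows "{x::real^2. x$2 > 0} \<subseteq> X"
proof
  fix x :: "real^2" assume "x \<in> {x. x$2 > 0}"
  then have x: "x$2 > 0" by simp
  have "\<not> {x::real^2. x$2 > 0} \<subseteq> - X"
  proof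
    assume "{x::real^2. x$2 > 0} \<subseteq> - X"
    then have "negligible {x::real^2. x$2 > 0}" using neg negligible_subset by blast
    moreover have "open {x::real^2. x$2 > 0}" by (intro open_Collect_less continuous_intros)
    moreover have "x \<in> {x. x$2 > 0}" using x by simp
    ultimately show False using open_not_negligible by blast
  qed
  then obtain w where w: "w \<in> X" "w$2 > 0" by auto
  \<comment> \<open>The second coordinate of \<open>h *v w = x\<close> determines \<open>a\<close>, and then the first determines \<open>s\<close>.\<close>
  define a where "a = (x$2 / w$2) powr (-2)"
  define s where "s = (a powr (1/2 - \<gamma>) * w$1 - x$1) / x$2"
  have "a > 0" using x w by (simp add: a_def)
  have "a powr (-1/2) = x$2 / w$2" using x w by (simp add: a_def powr_powr)
  then have "shearlet_h \<gamma> a s *v w = x"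
    using x w by (simp add: vec_eq_iff forall_2 shearlet_h_def matrix_vector_mult_def sum_2 s_def)
  then show "x \<in> X" using inv[OF shearlet_h_in_H[OF \<open>a > 0\<close>] w(1)] by metis
qed

text \<open>Derivatives of \<open>\<xi>\<close> are taken at interior points of its domain. On the upper half-plane the map
  \<open>quad_map\<close> is invertible onto the right half-plane, by means of a square root.\<close>

lemma Phi_image_contains_open:
  fixes P :: "real^2^2"
  assumes P: "invertible P" "\<And>x. Phi b x = P *v quad_map x"
  obtains W where "open W" "W \<noteq> {}" "W \<subseteq> Phi b ` {x. x$2 > 0}"
proof -
  obtain Q where PQ: "P ** Q = mat 1" using P(1) unfolding invertible_def by blast
  define W where "W = {y. (Q *v y)$1 > 0}"
  have "open W" unfolding W_def
    by (intro open_Collect_less continuous_intros)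
  moreover
  have QP: "Q ** P = mat 1" using PQ matrix_left_right_inverse by blast
  have "P *v vector [1, 0] \<in> W"
    by (simp add: W_def matrix_vector_mul_assoc QP)
  moreover have "y \<in> Phi b ` {x. x$2 > 0}" if "y \<in> W" for y
  proof -
    define z where "z = Q *v y"
    have z: "z$1 > 0" using that by (simp add: W_def z_def)
    define x :: "real^2" where "x = vector [z$2 / sqrt (z$1), sqrt (z$1)]"
    have "quad_map x = z" using z by (simp add: quad_map_def x_def vec_eq_iff forall_2)
    then have "Phi b x = y" by (simp add: P(2) z_def matrix_vector_mul_assoc PQ)
    moreover have "x$2 > 0" using z by (simp add: x_def)
    ultimately show ?thesis by blast
  qed
  ultimately show ?thesis using that by blast
qed

section \<open>The Jacobian of an intertwining map\<close>

lemma smooth_on_imp_differentiable: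
  assumes "smooth_on S f" "open W" "W \<subseteq> S" "x \<in> W"
  shows "f differentiable at x"
proof -
  have "x \<in> S" using assms by blast
  with assms(1) obtain U g where U: "open U" "x \<in> U" "\<forall>k. Ck_on k g U" "\<forall>y\<in>U \<inter> S. g y = f y"
    unfolding smooth_on_def by meson
  have "Ck_on (Suc 0) g U" using U(3) by blast
  then have "(g has_derivative frechet_derivative g (at x)) (at x)"
    using U(2) by (simp flip: frechet_derivative_works)
  then have "(f has_derivative frechet_derivative g (at x)) (at x)"
    by (rule has_derivative_transform_within_open[where s = "U \<inter> W"]) (use assms U in auto)
  then show ?thesis unfolding differentiable_def by blast
qed

text \<open>Differentiating \<open>\<xi> (A y) = A' (\<xi> y)\<close> gives \<open>J (A y) A = A' (J y)\<close> for the Jacobian matrix \<open>J\<close>;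
  the factors \<open>c\<close> cancel in the determinants.\<close>

lemma det_eq_if_intertwines:
  fixes \<xi> :: "real^'n \<Rightarrow> real^'n" and A A' :: "real^'n^'n"
  assumes W: "open W" "y \<in> W"
    and dy: "\<xi> differentiable at y" and dAy: "\<xi> differentiable at (A *v y)"
    and inter: "\<And>z. z \<in> W \<Longrightarrow> \<xi> (A *v z) = A' *v \<xi> z"
    and c: "\<bar>det (jacobian \<xi> (at y))\<bar> = c" "\<bar>det (jacobian \<xi> (at (A *v y)))\<bar> = c" "c > 0"
  shows "\<bar>det A\<bar> = \<bar>det A'\<bar>"
proof -
  let ?J = "\<lambda>y. jacobian \<xi> (at y)"
  have lin: "((\<lambda>z. B *v z) has_derivative (\<lambda>v. B *v v)) F" for B :: "real^'n^'n" and F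
    by (rule bounded_linear_imp_has_derivative[OF matrix_vector_mul_bounded_linear])
  have 1: "(\<xi> has_derivative (\<lambda>v. ?J y *v v)) (at y)"
    using dy by (simp add: jacobian_works)
  have 2: "(\<xi> has_derivative (\<lambda>v. ?J (A *v y) *v v)) (at (A *v y))"
    using dAy by (simp add: jacobian_works)
  have "((\<lambda>z. \<xi> (A *v z)) has_derivative (\<lambda>v. ?J (A *v y) *v (A *v v))) (at y)"
    using has_derivative_compose[OF lin 2] by simp
  then have 3: "((\<lambda>z. A' *v \<xi> z) has_derivative (\<lambda>v. ?J (A *v y) *v (A *v v))) (at y)"
    by (rule has_derivative_transform_within_open[OF _ W]) (rule inter)
  have "((\<lambda>z. A' *v \<xi> z) has_derivative (\<lambda>v. A' *v (?J y *v v))) (at y)"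
    by (rule has_derivative_compose[OF 1 lin])
  from has_derivative_unique[OF 3 this]
  have "(?J (A *v y) ** A) *v v = (A' ** ?J y) *v v" for v
    by (simp add: matrix_vector_mul_assoc fun_eq_iff)
  then have "?J (A *v y) ** A = A' ** ?J y" by (simp add: matrix_eq)
  then have "\<bar>det (?J (A *v y))\<bar> * \<bar>det A\<bar> = \<bar>det A'\<bar> * \<bar>det (?J y)\<bar>"
    by (metis det_mul abs_mult)
  then show ?thesis using c by simp
qed

section \<open>Shearlet groups are pairwise inequivalent\<close>

theorem mainTheorem4:
  fixes \<gamma> \<gamma>' :: real and D D' :: "(2, 2) data_tuple"
  assumes "\<gamma> \<le> 1/2" and "\<gamma>' \<le> 1/2" and "\<gamma> \<noteq> \<gamma>'"
    and "is_data_set D" and "ds_group D = shearlet_group \<gamma>"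
    and "is_data_set D'" and "ds_group D' = shearlet_group \<gamma>'"
  shows "\<not> (\<exists>\<theta> \<psi> \<xi>. orbit_equivalence D D' \<theta> \<psi> \<xi>)"
proof
  assume "\<exists>\<theta> \<psi> \<xi>. orbit_equivalence D D' \<theta> \<psi> \<xi>"
  then obtain \<theta> \<psi> \<xi> c where om: "orbit_map D D' \<theta> \<psi> \<xi>" and c: "c > 0"
    and J: "\<And>y. y \<in> ds_Y D \<Longrightarrow> \<bar>det (jacobian \<xi> (at y))\<bar> = c"
    unfolding orbit_equivalence_def by blast
  note H = shearlet_data_set[OF assms(4,5)] and H' = shearlet_data_set[OF assms(6,7)]
  let ?\<Phi> = "Phi (ds_basis D)" and ?\<Phi>' = "Phi (ds_basis D')"
  have basis: "is_basis_family (ds_basis D) Sigma3_perp" "is_basis_family (ds_basis D') Sigma3_perp"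
    using assms(4,6) H(1) H'(1) by (auto simp: is_data_set_def)
  have inv: "\<And>h x. h \<in> shearlet_H \<gamma> \<Longrightarrow> x \<in> ds_X D \<Longrightarrow> h *v x \<in> ds_X D"
    and neg: "negligible (- ds_X D)" and Y: "ds_Y D = ?\<Phi> ` ds_X D"
    using assms(4) H(2) by (auto simp: is_data_set_def)
  from om have \<theta>: "diffeomorphism (shearlet_H \<gamma>) (shearlet_H \<gamma>') \<theta>"
    and hom: "\<And>g h. g \<in> shearlet_H \<gamma> \<Longrightarrow> h \<in> shearlet_H \<gamma> \<Longrightarrow> \<theta> (g ** h) = \<theta> g ** \<theta> h"
    and \<psi>: "\<And>h x. h \<in> shearlet_H \<gamma> \<Longrightarrow> x \<in> ds_X D \<Longrightarrow> \<psi> (h *v x) = \<theta> h *v \<psi> x"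
    and \<xi>: "smooth_on (ds_Y D) \<xi>"
    and \<xi>\<Phi>: "\<And>x. x \<in> ds_X D \<Longrightarrow> \<xi> (?\<Phi> x) = ?\<Phi>' (\<psi> x)"
    unfolding orbit_map_def Lie_group_isomorphism_def diffeomorphism_def H(2) H'(2) by auto
  obtain P where P: "invertible P" "\<And>x. ?\<Phi> x = P *v quad_map x"
    using Phi_Sigma3_perp[OF basis(1)] by metis
  obtain P' where P': "invertible P'" "\<And>x. ?\<Phi>' x = P' *v quad_map x"
    using Phi_Sigma3_perp[OF basis(2)] by metis

  define a where "a = 2 powr (1 / (1 - \<gamma>))"
  have a: "a > 0" "a powr (1 - \<gamma>) = 2" using assms(1) by (simp_all add: a_def powr_powr)
  let ?g = "shearlet_h \<gamma> a 0"
  have g: "?g \<in> shearlet_H \<gamma>" using a by simp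
  obtain a' s' where a': "a' > 0" "a' powr (1 - \<gamma>') = 2" and \<theta>g: "\<theta> ?g = shearlet_h \<gamma>' a' s'"
  proof (rule shearlet_hom_dilation[of \<theta> \<gamma> \<gamma>' a])
    show "\<theta> \<in> shearlet_H \<gamma> \<rightarrow> shearlet_H \<gamma>'" "inj_on \<theta> (shearlet_H \<gamma>)"
      using \<theta> by (auto simp: diffeomorphism_def bij_betw_def)
  qed (use hom a in auto)
  obtain A where A: "det A = a powr (- (1 + \<gamma>))" "\<And>x. ?\<Phi> (?g *v x) = A *v ?\<Phi> x"
    using shearlet_Phi_equivariant[OF P a(1)] by metis
  obtain A' where A': "det A' = a' powr (- (1 + \<gamma>'))" "\<And>x. ?\<Phi>' (\<theta> ?g *v x) = A' *v ?\<Phi>' x"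
    using shearlet_Phi_equivariant[OF P' a'(1)] \<theta>g by metis

  obtain W where W: "open W" "W \<noteq> {}" "W \<subseteq> ?\<Phi> ` {x. x$2 > 0}"
    by (rule Phi_image_contains_open[OF P])
  have "{x. x$2 > 0} \<subseteq> ds_X D"
    using inv neg by (rule shearlet_upper_half_plane_subset)
  then have WY: "W \<subseteq> ds_Y D" using W(3) unfolding Y by blast
  have AY: "A *v y \<in> ds_Y D" "\<xi> (A *v y) = A' *v \<xi> y" if yY: "y \<in> ds_Y D" for y
  proof -
    obtain x where x: "x \<in> ds_X D" "y = ?\<Phi> x" using yY unfolding Y by blast
    show "A *v y \<in> ds_Y D" using inv[OF g x(1)] A(2) x(2) Y by (metis image_eqI)
    have "\<xi> (A *v y) = \<xi> (?\<Phi> (?g *v x))" by (simp add: A(2) x(2))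
    also have "\<dots> = A' *v ?\<Phi>' (\<psi> x)" using \<xi>\<Phi>[OF inv[OF g x(1)]] \<psi>[OF g x(1)] A'(2) by simp
    finally show "\<xi> (A *v y) = A' *v \<xi> y" using \<xi>\<Phi>[OF x(1)] x(2) by simp
  qed
  obtain y where y: "y \<in> W" using W(2) by blast
  \<comment> \<open>The point \<open>A *v y\<close> may lie outside \<open>W\<close>, but the open set \<open>A W\<close> is a neighbourhood of it in the
    domain of \<open>\<xi>\<close>.\<close>
  have "A *v y \<in> (\<lambda>z. A *v z) ` W" using y by blast
  moreover have "open ((\<lambda>z. A *v z) ` W)"
  proof (rule open_surjective_linear_image[OF W(1)])
    have "invertible A" using A(1) a(1) by (simp add: invertible_det_nz)
    then show "surj (\<lambda>z. A *v z)"
      using invertible_right_inverse matrix_right_invertible_surjective by blast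
  qed simp
  moreover have "(\<lambda>z. A *v z) ` W \<subseteq> ds_Y D" using AY(1) WY by blast
  ultimately have "\<xi> differentiable at (A *v y)" using smooth_on_imp_differentiable[OF \<xi>] by metis
  moreover have "\<xi> differentiable at y" by (rule smooth_on_imp_differentiable[OF \<xi> W(1) WY y])
  ultimately have "\<bar>det A\<bar> = \<bar>det A'\<bar>"
    using W(1) WY y AY J c by (intro det_eq_if_intertwines[of W y \<xi> A A' c]) auto
  then have "ln (a powr (- (1 + \<gamma>))) = ln (a' powr (- (1 + \<gamma>')))" using A(1) A'(1) by simp
  then have "(1 + \<gamma>) * ln a = (1 + \<gamma>') * ln a'" using a(1) a'(1) by (simp add: ln_powr algebra_simps)
  moreover have e: "(1 - \<gamma>) * ln a = ln 2" "(1 - \<gamma>') * ln a' = ln 2"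
    using arg_cong[OF a(2), of ln] arg_cong[OF a'(2), of ln] a(1) a'(1) by (simp_all add: ln_powr)
  ultimately have "ln a = ln a'" by (simp add: algebra_simps)
  moreover from e have "ln a' \<noteq> 0" by auto
  ultimately have "\<gamma> = \<gamma>'" using e by (metis diff_left_imp_eq mult_cancel_right)
  with assms(3) show False by contradiction
qed

end
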